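(* Let $n\geq1$, $m\in[n]$, $r\geq 0$ and $\mathbf{X}=(X_1,\dots,X_n)\sim\mu^n$. Then for every $t>0$: (i) $\mathbb{P}\{\hat M(\mathbf{X})-T_m(\mathbf{X})>t\}\leq e^{-mt^2/2}$; (ii) $\mathbb{P}\{\hat M(\mathbf{X})-2T_m(\mathbf{X})>t\}\leq \exp\big(-mt/(4(e-2))\big)$. (iii) If $m<n$, then $\mathbb{E}[T_m(\mathbf{X})-\hat M(\mathbf{X})]\leq \ln\frac{n}{n-m}\leq \frac{m}{n-m}$.
   Context: $\mathcal{X}$ is a Hausdorff space with Borel probability measure $\mu$ and a continuous function $d:\mathcal{X}\times\mathcal{X}\to[0,\infty)$ (not necessarily a metric) with $d(x,x)=0$ and $d(x,y)=d(y,x)$. $[n]=\{1,\dots,n\}$, $B(x,r)=\{y: d(x,y)\leq r\}$, and $A^c$ is the complement of $A$ (an empty intersection is $\mathcal{X}$). $X_1,\dots,X_n$ are independent with law $\mu$. The conditional missing mass is $\hat M(\mathbf{X})=\mu\big(\bigcap_{k\in[n]}B(X_k,r)^c\big)$, and for $m\in[n]$ $$T_m(\mathbf{X})=\frac1m\sum_{k=n-m+1}^n\mathbf{1}\Big\{X_k\in\bigcap_{i:\,i<k}B(X_i,r)^c\Big\}.$$ *)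

theory Defs
  imports "HOL-Probability.Probability"
begin

definition gball :: "('a \<Rightarrow> 'a \<Rightarrow> real) \<Rightarrow> 'a \<Rightarrow> real \<Rightarrow> 'a set" where
  "gball d x r = {y. d x y \<le> r}"

text \<open>A sample is a function on the index set \<open>{1..n}\<close>. Intersections over an empty index
  set are \<open>UNIV\<close>, so the \<open>k = 1\<close> summand of the estimator is always 1.\<close>

definition cond_missing_mass ::
  "'a measure \<Rightarrow> ('a \<Rightarrow> 'a \<Rightarrow> real) \<Rightarrow> real \<Rightarrow> nat \<Rightarrow> (nat \<Rightarrow> 'a) \<Rightarrow> real" where
  "cond_missing_mass \<mu> d r n x = measure \<mu> (\<Inter>k\<in>{1..n}. - gball d (x k) r)"

definition mass_estimator ::
  "('a \<Rightarrow> 'a \<Rightarrow> real) \<Rightarrow> real \<Rightarrow> nat \<Rightarrow> nat \<Rightarrow> (nat \<Rightarrow> 'a) \<Rightarrow> real" where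
  "mass_estimator d r n m x =
     (1 / real m) * (\<Sum>k = n - m + 1..n. indicator (\<Inter>i\<in>{1..<k}. - gball d (x i) r) (x k))"

abbreviation sample_law :: "'a measure \<Rightarrow> nat \<Rightarrow> (nat \<Rightarrow> 'a) measure" where
  "sample_law \<mu> n \<equiv> Pi\<^sub>M {1..n} (\<lambda>_. \<mu>)"

end

theory Submission
  imports Defs
begin

text \<open>Write \<open>M\<^sub>k\<close> for the missing mass of \<open>X\<^sub>1, \<dots>, X\<^sub>k\<close> and \<open>\<xi>\<^sub>k\<close> for the indicator that \<open>X\<^sub>k\<close> avoids the
  earlier balls. Given the past, \<open>\<xi>\<^sub>k\<close> is Bernoulli with mean \<open>M\<^bsub>k-1\<^esub> \<ge> M\<^sub>n\<close>, so both tail bounds follow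
  from Chernoff's method once the conditional moment generating function of
  \<open>M\<^bsub>k-1\<^esub> - c \<xi>\<^sub>k\<close> is bounded for \<open>c = 1, 2\<close>.
  For the bias, \<open>\<xi>\<^sub>k - M\<^bsub>k-1\<^esub>\<close> has mean zero, and
  \<open>\<bbbE>[M\<^sub>j - M\<^bsub>j+1\<^esub>] \<le> 1 / (j + 1)\<close>: by exchangeability this is the expected mass of the points in
  the ball around \<open>X\<^sub>i\<close> and in none of the other \<open>j\<close> balls, for each of the \<open>j + 1\<close> indices \<open>i\<close>, and these
  sets are disjoint.

  The set \<open>{(x, y). d x y > r}\<close> need not belong to the product \<open>\<sigma>\<close>-algebra, because \<open>\<X>\<close> is not assumed
  second countable. Hence \<open>M\<^sub>k\<close> and \<open>\<xi>\<^sub>k\<close> may fail to be jointly measurable. Integrating out the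
  coordinates from the last to the first meets only measurable sections, which is enough.\<close>

section \<open>Scalar bounds on Bernoulli moment generating functions\<close>

lemma exp_minus_le_quadratic:
  fixes x :: real
  assumes "0 \<le> x"
  shows "exp (- x) \<le> 1 - x + x\<^sup>2 / 2"
proof -
  have "0 < 1 - x + x\<^sup>2 / 2"
    using sum_power2_gt_zero_iff[of "x - 1" 1] by (simp add: power2_eq_square algebra_simps)
  moreover have "1 \<le> (1 - x + x\<^sup>2 / 2) * (1 + x + x\<^sup>2 / 2)"
  proof -
    have "(1 - x + x\<^sup>2 / 2) * (1 + x + x\<^sup>2 / 2) = 1 + x ^ 4 / 4"
      by (simp add: power2_eq_square power4_eq_xxxx algebra_simps)
    then show ?thesis by simp
  qed
  moreover have "1 + x + x\<^sup>2 / 2 \<le> exp x"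
    using assms by (rule exp_lower_Taylor_quadratic)
  ultimately have "1 \<le> (1 - x + x\<^sup>2 / 2) * exp x"
    by (meson less_imp_le mult_left_mono order_trans)
  then show ?thesis
    by (simp add: exp_minus field_simps)
qed

text \<open>For \<open>\<xi>\<close> Bernoulli with mean \<open>p\<close> the left side is the mean
  of \<open>exp (l * (p - \<xi>))\<close>. By \<open>1 + u \<le> exp u\<close> it is at most
  \<open>exp (p * (exp (- l) - 1 + l))\<close>, and the quadratic bound on \<open>exp (- l)\<close>
  leaves at most \<open>p * l\<^sup>2 / 2\<close> in the exponent.\<close>

lemma mgf_variance_bound:
  fixes l p :: real
  assumes "0 \<le> l" "0 \<le> p" "p \<le> 1"
  shows "exp (l * p) * (1 - p + p * exp (- l)) \<le> exp (l\<^sup>2 / 2)"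
proof -
  have "exp (- l) \<le> 1 - l + l\<^sup>2 / 2"
    using exp_minus_le_quadratic[OF \<open>0 \<le> l\<close>] .
  then have "p * exp (- l) \<le> p * (1 - l + l\<^sup>2 / 2)"
    using assms by (intro mult_left_mono)
  moreover have "p * l\<^sup>2 \<le> l\<^sup>2"
    using assms by (simp add: mult_left_le_one_le)
  ultimately have "l * p + (p * exp (- l) - p) \<le> l\<^sup>2 / 2"
    by (simp add: algebra_simps)
  moreover have "1 - p + p * exp (- l) \<le> exp (p * exp (- l) - p)"
    using exp_ge_add_one_self[of "p * exp (- l) - p"] by linarith
  then have "exp (l * p) * (1 - p + p * exp (- l)) \<le> exp (l * p) * exp (p * exp (- l) - p)"
    by (intro mult_left_mono) auto
  ultimately show ?thesis
    by (smt (verit) exp_add exp_le_cancel_iff)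
qed

text \<open>Doubling the indicator creates slack: for \<open>l \<le> 1 / 2\<close> the factor
  \<open>exp (- (l * 2))\<close> is at most \<open>1 - l\<close>, so the Bernoulli factor is at most
  \<open>1 - l * p \<le> exp (- (l * p))\<close> and cancels \<open>exp (l * p)\<close> with no
  quadratic remainder.\<close>

lemma mgf_relative_bound:
  fixes l p :: real
  assumes "0 \<le> l" "l \<le> 1 / 2" "0 \<le> p" "p \<le> 1"
  shows "exp (l * p) * (1 - p + p * exp (- (l * 2))) \<le> 1"
proof -
  have "exp (- (l * 2)) \<le> 1 / (1 + l * 2)"
    using exp_ge_add_one_self[of "l * 2"] assms by (simp add: exp_minus field_simps)
  also have "\<dots> \<le> 1 - l"
  proof -
    have "0 \<le> l * (1 - 2 * l)"
      using assms by (intro mult_nonneg_nonneg) auto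
    then show ?thesis
      using assms by (simp add: field_simps)
  qed
  finally have "p * exp (- (l * 2)) \<le> p * (1 - l)"
    using assms by (intro mult_left_mono)
  then have "1 - p + p * exp (- (l * 2)) \<le> 1 + (- (l * p))"
    by (simp add: algebra_simps)
  also have "\<dots> \<le> exp (- (l * p))"
    by (rule exp_ge_add_one_self)
  finally have "exp (l * p) * (1 - p + p * exp (- (l * 2))) \<le> exp (l * p) * exp (- (l * p))"
    by (intro mult_left_mono) auto
  then show ?thesis
    by (simp flip: exp_add)
qed

section \<open>Missing mass and novelty for a family of sets \<open>A x\<close>, the abstract
  complements of balls\<close>

locale exploration = prob_space \<mu> for \<mu> :: "'a measure" +
  fixes A :: "'a \<Rightarrow> 'a set"
  assumes space_UNIV: "space \<mu> = UNIV"
    and sets_A [measurable]: "A x \<in> sets \<mu>"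
begin

sublocale seq: product_prob_space "\<lambda>_::nat. \<mu>" UNIV
  by unfold_locales

text \<open>Arbitrary index sets occur because the bias argument leaves out one sample point at a
  time.\<close>

definition missing :: "nat set \<Rightarrow> (nat \<Rightarrow> 'a) \<Rightarrow> real" where
  "missing S x = prob (\<Inter>i\<in>S. A (x i))"

definition novel :: "nat \<Rightarrow> (nat \<Rightarrow> 'a) \<Rightarrow> real" where
  "novel k x = indicator (\<Inter>i\<in>{1..<k}. A (x i)) (x k)"

lemma sets_INT_A [measurable]: "finite S \<Longrightarrow> (\<Inter>i\<in>S. A (x i)) \<in> sets \<mu>"
  by (cases "S = {}") (auto simp: space_UNIV[symmetric])

lemma missing_nonneg [simp]: "0 \<le> missing S x" and missing_le_1 [simp]: "missing S x \<le> 1"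
  by (auto simp: missing_def)

lemma missing_cong: "(\<And>i. i \<in> S \<Longrightarrow> x i = y i) \<Longrightarrow> missing S x = missing S y"
  unfolding missing_def by (simp cong: INF_cong_simp)

lemma missing_antimono: "finite T \<Longrightarrow> S \<subseteq> T \<Longrightarrow> missing T x \<le> missing S x"
  unfolding missing_def
  by (intro finite_measure_mono sets_INT_A) (auto intro: finite_subset)

lemma novel_cong: "(\<And>i. i \<in> {1..k} \<Longrightarrow> x i = y i) \<Longrightarrow> 1 \<le> k \<Longrightarrow> novel k x = novel k y"
  unfolding novel_def by (auto simp: indicator_def)

lemma novel_bounds [simp]: "0 \<le> novel k x" "novel k x \<le> 1"
  by (auto simp: novel_def indicator_def)

text \<open>With the past frozen, novelty of the next point is the indicator of a measurable set of
  mass \<open>missing {1..k} x\<close>. This is the conditional Bernoulli law.\<close>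

lemma novel_upd:
  "novel (Suc k) (x(Suc k := y)) = indicator (\<Inter>i\<in>{1..k}. A (x i)) y"
  unfolding novel_def by (auto simp: indicator_def)

section \<open>Integrating out sample coordinates from the last to the first\<close>

lemma measurable_nn_integral_upd:
  fixes f :: "(nat \<Rightarrow> 'a) \<Rightarrow> ennreal"
  assumes "f \<in> borel_measurable (Pi\<^sub>M (insert i I) (\<lambda>_. \<mu>))"
  shows "(\<lambda>x. \<integral>\<^sup>+ y. f (x(i := y)) \<partial>\<mu>) \<in> borel_measurable (Pi\<^sub>M I (\<lambda>_. \<mu>))"
proof (rule borel_measurable_nn_integral)
  show "(\<lambda>(x, y). f (x(i := y))) \<in> borel_measurable (Pi\<^sub>M I (\<lambda>_. \<mu>) \<Otimes>\<^sub>M \<mu>)"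
    using measurable_compose[OF measurable_add_dim assms] by (simp add: case_prod_unfold)
qed

text \<open>Only the one-variable sections in the last coordinate are ever integrated, so \<open>U\<close> need not be
  jointly measurable; \<open>nn_integral\<close> is monotone on non-measurable functions as well.\<close>

lemma nn_integral_PiM_le_supermartingale:
  fixes U :: "nat \<Rightarrow> (nat \<Rightarrow> 'a) \<Rightarrow> ennreal"
  assumes "f \<in> borel_measurable (sample_law \<mu> n)"
    and "\<And>x. f x \<le> U n x"
    and "\<And>k x. k < n \<Longrightarrow> (\<integral>\<^sup>+ y. U (Suc k) (x(Suc k := y)) \<partial>\<mu>) \<le> U k x"
  shows "(\<integral>\<^sup>+ x. f x \<partial>sample_law \<mu> n) \<le> U 0 (\<lambda>_. undefined)"
  using assms
proof (induction n arbitrary: f)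
  \<comment> \<open>The empty product is the point mass at
    \<open>\<lambda>_. undefined\<close>.\<close>
  case 0
  then show ?case
    by (simp add: seq.nn_integral_empty)
next
  case (Suc n)
  have ins: "{1..Suc n} = insert (Suc n) {1..n}" by auto
  \<comment> \<open>Unlike \<open>U n\<close>, the function \<open>?g\<close> is jointly measurable
    again, so it can replace \<open>f\<close> in the induction hypothesis.\<close>
  let ?g = "\<lambda>x. \<integral>\<^sup>+ y. f (x(Suc n := y)) \<partial>\<mu>"
  have f: "f \<in> borel_measurable (Pi\<^sub>M (insert (Suc n) {1..n}) (\<lambda>_. \<mu>))"
    using Suc.prems(1) by (simp only: ins)
  have "(\<integral>\<^sup>+ x. f x \<partial>sample_law \<mu> (Suc n)) = (\<integral>\<^sup>+ x. ?g x \<partial>sample_law \<mu> n)"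
    unfolding ins by (rule seq.product_nn_integral_insert[OF _ _ f]) auto
  also have "\<dots> \<le> U 0 (\<lambda>_. undefined)"
  proof (rule Suc.IH[of ?g])
    show "?g \<in> borel_measurable (sample_law \<mu> n)"
      using f by (rule measurable_nn_integral_upd)
    show "?g x \<le> U n x" for x
    proof -
      have "?g x \<le> (\<integral>\<^sup>+ y. U (Suc n) (x(Suc n := y)) \<partial>\<mu>)"
        by (intro nn_integral_mono Suc.prems(2))
      also have "\<dots> \<le> U n x"
        by (rule Suc.prems(3)) simp
      finally show ?thesis .
    qed
    show "(\<integral>\<^sup>+ y. U (Suc k) (x(Suc k := y)) \<partial>\<mu>) \<le> U k x" if "k < n" for k x
      using that by (intro Suc.prems(3)) simp
  qed
  finally show ?case .
qed

lemma sum_upd: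
  assumes "\<And>i x y. i \<in> {a..k} \<Longrightarrow> (\<And>j. j \<le> k \<Longrightarrow> x j = y j) \<Longrightarrow> g i x = (g i y :: real)"
  shows "(\<Sum>i=a..k. g i (x(Suc k := y))) = (\<Sum>i=a..k. g i x)"
  by (intro sum.cong assms) auto

section \<open>One-step integrals and the Chernoff tail bound\<close>

lemma exp_moment_indicator:
  assumes [measurable]: "B \<in> sets \<mu>"
  shows "(\<integral>\<^sup>+ y. ennreal (exp (u - w * indicator B y)) \<partial>\<mu>)
      = ennreal (exp u * (1 - prob B + prob B * exp (- w)))"
proof -
  have "(\<integral>\<^sup>+ y. ennreal (exp (u - w * indicator B y)) \<partial>\<mu>)
      = (\<integral>\<^sup>+ y. ennreal (exp u) * indicator (- B) y + ennreal (exp u * exp (- w)) * indicator B y \<partial>\<mu>)"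
    by (intro nn_integral_cong) (auto simp: indicator_def exp_diff exp_minus divide_inverse)
  also have "\<dots> = ennreal (exp u) * emeasure \<mu> (space \<mu> - B) + ennreal (exp u * exp (- w)) * emeasure \<mu> B"
    by (subst nn_integral_add) (auto simp: space_UNIV Compl_eq_Diff_UNIV nn_integral_cmult_indicator simp flip: space_UNIV)
  also have "\<dots> = ennreal (exp u * (1 - prob B + prob B * exp (- w)))"
    by (simp add: emeasure_eq_measure prob_compl flip: ennreal_mult ennreal_plus)
       (simp add: algebra_simps)
  finally show ?thesis .
qed

text \<open>The shift \<open>c\<close> keeps the integrand nonnegative, so that the mean-zero
  property fits the nonnegative integral used for iterated integration.\<close>

lemma mean_centred_indicator:
  assumes [measurable]: "B \<in> sets \<mu>" and nonneg: "\<And>y. 0 \<le> c + (indicator B y - prob B)"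
  shows "(\<integral>\<^sup>+ y. ennreal (c + (indicator B y - prob B)) \<partial>\<mu>) = ennreal c"
proof -
  have int: "integrable \<mu> (indicator B :: 'a \<Rightarrow> real)"
    by (simp add: emeasure_eq_measure)
  have "(\<integral>\<^sup>+ y. ennreal (c + (indicator B y - prob B)) \<partial>\<mu>)
      = ennreal (\<integral>y. c + (indicator B y - prob B) \<partial>\<mu>)"
    using int by (intro nn_integral_eq_integral AE_I2 nonneg) auto
  also have "(\<integral>y. c + (indicator B y - prob B) \<partial>\<mu>) = c"
    using int by (simp add: prob_space space_UNIV prob_space[unfolded space_UNIV])
  finally show ?thesis .
qed

text \<open>The cost \<open>s\<close> per step turns the exponential of the accumulated
  \<open>l * (missing {1..k-1} x - c * novel k x)\<close> into a supermartingale; Markov's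
  inequality then gives the tail.\<close>

lemma chernoff_missing:
  fixes c l s t :: real
  assumes "m \<in> {1..n}" and "0 \<le> l"
    and mgf: "\<And>p. 0 \<le> p \<Longrightarrow> p \<le> 1 \<Longrightarrow> exp (l * p) * (1 - p + p * exp (- (l * c))) \<le> exp s"
  shows "\<P>(x in sample_law \<mu> n. missing {1..n} x - c * ((1 / real m) * (\<Sum>k=n-m+1..n. novel k x)) > t)
    \<le> exp (real m * (s - l * t))" (is "measure _ ?E \<le> _")
proof (cases "?E \<in> sets (sample_law \<mu> n)")
  \<comment> \<open>\<open>measure\<close> is 0 on non-measurable sets.\<close>
  case False
  then show ?thesis by (simp add: measure_notin_sets)
next
  case True
  let ?P = "sample_law \<mu> n"
  interpret P: prob_space ?P by (rule prob_space_PiM) (rule prob_space_axioms)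
  have m: "0 < m" "m \<le> n" using assms(1) by auto
  define g where "g = (\<lambda>k x. l * (missing {1..k-1} x - c * novel k x) - s)"
  define U where "U = (\<lambda>k x. ennreal (exp (\<Sum>i=n-m+1..k. g i x)))"
  \<comment> \<open>Markov's inequality in product form: the scaled indicator of the event is
    measurable and lies below \<open>U n\<close>, which itself may not be measurable.\<close>
  have "(\<integral>\<^sup>+ x. ennreal (exp (real m * (l * t - s))) * indicator ?E x \<partial>?P) \<le> U 0 (\<lambda>_. undefined)"
  proof (rule nn_integral_PiM_le_supermartingale)
    show "(\<lambda>x. ennreal (exp (real m * (l * t - s))) * indicator ?E x) \<in> borel_measurable ?P"
      using True by measurable
    show "ennreal (exp (real m * (l * t - s))) * indicator ?E x \<le> U n x" for x
    proof (cases "x \<in> ?E")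
      case True
      have "real m * t \<le> real m * missing {1..n} x - c * (\<Sum>k=n-m+1..n. novel k x)"
        using True m by (auto simp: field_simps)
      also have "real m * missing {1..n} x = (\<Sum>k=n-m+1..n. missing {1..n} x)"
        using m by simp
      also have "\<dots> \<le> (\<Sum>k=n-m+1..n. missing {1..k-1} x)"
        by (intro sum_mono missing_antimono) auto
      finally have "l * (real m * t) \<le> l * (\<Sum>k=n-m+1..n. missing {1..k-1} x - c * novel k x)"
        using \<open>0 \<le> l\<close> by (intro mult_left_mono) (auto simp: sum_subtractf sum_distrib_left)
      moreover have "(\<Sum>k=n-m+1..n. g k x)
          = l * (\<Sum>k=n-m+1..n. missing {1..k-1} x - c * novel k x) - real m * s"
        using m by (simp add: g_def sum_subtractf flip: sum_distrib_left)
      ultimately have "real m * (l * t - s) \<le> (\<Sum>k=n-m+1..n. g k x)"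
        unfolding right_diff_distrib mult.left_commute[of "real m" l] by linarith
      then show ?thesis
        unfolding U_def indicator_simps(1)[OF True] by (simp only: mult_1_right exp_le_cancel_iff ennreal_leI)
    next
      case False
      show ?thesis unfolding indicator_simps(2)[OF False] by simp
    qed
    show "(\<integral>\<^sup>+ y. U (Suc k) (x(Suc k := y)) \<partial>\<mu>) \<le> U k x" if "k < n" for k x
    proof (cases "n - m \<le> k")
      \<comment> \<open>Here \<open>Suc k \<le> n - m\<close>, so both sums are empty and
        \<open>U\<close> is still 1.\<close>
      case False
      then show ?thesis by (simp add: U_def emeasure_space_1)
    next
      case True
      let ?B = "\<Inter>i\<in>{1..k}. A (x i)" and ?S = "\<Sum>i=n-m+1..k. g i x"
      define p where "p = missing {1..k} x"
      have g_prev: "(\<Sum>i=n-m+1..k. g i (x(Suc k := y))) = ?S" for y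
        unfolding g_def
        by (intro sum_upd arg_cong2[where f="\<lambda>u v. l * (u - c * v) - s"] missing_cong novel_cong) auto
      have g_last: "g (Suc k) (x(Suc k := y)) = l * (p - c * indicator ?B y) - s" for y
        unfolding g_def p_def novel_upd diff_Suc_1
        by (intro arg_cong2[where f="\<lambda>u v. l * (u - c * v) - s"] missing_cong) auto
      have "(\<integral>\<^sup>+ y. U (Suc k) (x(Suc k := y)) \<partial>\<mu>)
          = (\<integral>\<^sup>+ y. ennreal (exp ((?S + l * p - s) - (l * c) * indicator ?B y)) \<partial>\<mu>)"
        using True by (simp add: U_def g_prev[simplified] g_last[simplified] algebra_simps)
      also have "\<dots> = ennreal (exp (?S + l * p - s) * (1 - p + p * exp (- (l * c))))"
        unfolding p_def missing_def by (rule exp_moment_indicator) auto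
      also have "\<dots> = ennreal (exp ?S * exp (- s) * (exp (l * p) * (1 - p + p * exp (- (l * c)))))"
        by (simp add: exp_add exp_diff exp_minus field_simps)
      also have "\<dots> \<le> ennreal (exp ?S * exp (- s) * exp s)"
        using mgf[of p] by (intro ennreal_leI mult_left_mono) (auto simp: p_def)
      also have "\<dots> = U k x"
        by (simp add: U_def exp_minus)
      finally show ?thesis .
    qed
  qed
  then have "ennreal (exp (real m * (l * t - s)) * P.prob ?E) \<le> 1"
    unfolding nn_integral_cmult_indicator[OF True]
    unfolding P.emeasure_eq_measure U_def using m by (simp add: ennreal_mult)
  then have "exp (real m * (l * t - s)) * P.prob ?E \<le> 1"
    by (simp only: ennreal_le_1)
  then have "P.prob ?E \<le> exp (- (real m * (l * t - s)))"
    by (simp only: exp_minus inverse_eq_divide pos_le_divide_eq[OF exp_gt_zero] mult.commute[of "P.prob ?E"])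
  moreover have "- (real m * (l * t - s)) = real m * (s - l * t)"
    by (simp only: right_diff_distrib minus_diff_eq)
  ultimately show ?thesis
    by (simp only:)
qed

text \<open>Given the past, \<open>novel k\<close> has mean \<open>missing {1..k-1} x\<close>, so
  each increment averages to zero over its own coordinate. The bias bound uses the upper half of the
  resulting mean-zero property.\<close>

lemma novel_martingale:
  assumes "m \<in> {1..n}"
    and meas: "(\<lambda>x. \<Sum>k=n-m+1..n. novel k x - missing {1..k-1} x) \<in> borel_measurable (sample_law \<mu> n)"
  shows "(\<integral>x. (\<Sum>k=n-m+1..n. novel k x - missing {1..k-1} x) \<partial>sample_law \<mu> n) \<le> 0"
proof -
  let ?P = "sample_law \<mu> n"
  interpret P: prob_space ?P by (rule prob_space_PiM) (rule prob_space_axioms)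
  have m: "0 < m" "m \<le> n" using assms(1) by auto
  define g where "g = (\<lambda>k x. novel k x - missing {1..k-1} x)"
  have g: "-1 \<le> g k x" "g k x \<le> 1" for k x
    unfolding g_def using novel_bounds[of k x] missing_nonneg[of "{1..k-1}" x] missing_le_1[of "{1..k-1}" x]
    by linarith+
  have lower: "- real m \<le> (\<Sum>k=n-m+1..j. g k x)" if "j \<le> n" for j x
  proof -
    have "(\<Sum>k=n-m+1..j. - 1) \<le> (\<Sum>k=n-m+1..j. g k x)"
      by (intro sum_mono g)
    then show ?thesis using that m by (auto simp: of_nat_diff)
  qed
  have upper: "(\<Sum>k=n-m+1..n. g k x) \<le> real m" for x
    using sum_mono[of "{n-m+1..n}" "\<lambda>k. g k x" "\<lambda>_. 1"] g m by simp
  \<comment> \<open>There are at most \<open>m\<close> increments, each at least -1, so the shift by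
    \<open>m\<close> keeps every partial sum up to \<open>n\<close> nonnegative.\<close>
  define U where "U = (\<lambda>k x. ennreal (real m + (\<Sum>i=n-m+1..k. g i x)))"
  have D [measurable]: "(\<lambda>x. \<Sum>k=n-m+1..n. g k x) \<in> borel_measurable ?P"
    using meas unfolding g_def .
  have "(\<integral>\<^sup>+ x. U n x \<partial>?P) \<le> U 0 (\<lambda>_. undefined)"
  proof (rule nn_integral_PiM_le_supermartingale)
    show "U n \<in> borel_measurable ?P" unfolding U_def by measurable
    show "(\<integral>\<^sup>+ y. U (Suc k) (x(Suc k := y)) \<partial>\<mu>) \<le> U k x" if "k < n" for k x
    proof (cases "n - m \<le> k")
      case False
      then show ?thesis by (simp add: U_def emeasure_space_1)
    next
      case True
      let ?B = "\<Inter>i\<in>{1..k}. A (x i)" and ?S = "\<Sum>i=n-m+1..k. g i x"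
      have B: "?B \<in> sets \<mu>" by simp
      have g_prev: "(\<Sum>i=n-m+1..k. g i (x(Suc k := y))) = ?S" for y
        unfolding g_def by (intro sum_upd arg_cong2[where f="(-)"] missing_cong novel_cong) auto
      have g_last: "g (Suc k) (x(Suc k := y)) = indicator ?B y - prob ?B" for y
        unfolding g_def novel_upd diff_Suc_1 missing_def[symmetric]
        by (intro arg_cong2[where f="(-)"] missing_cong) auto
      have nonneg: "0 \<le> real m + ?S + (indicator ?B y - prob ?B)" for y
        using lower[of "Suc k" "x(Suc k := y)"] True that g_prev[of y] g_last[of y] by simp
      have "(\<integral>\<^sup>+ y. U (Suc k) (x(Suc k := y)) \<partial>\<mu>)
          = (\<integral>\<^sup>+ y. ennreal (real m + ?S + (indicator ?B y - prob ?B)) \<partial>\<mu>)"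
        using True by (simp add: U_def g_prev[simplified] g_last[simplified] algebra_simps)
      also have "\<dots> = U k x"
        unfolding U_def by (rule mean_centred_indicator[OF B nonneg])
      finally show ?thesis by simp
    qed
  qed simp
  then have "(\<integral>\<^sup>+ x. ennreal (real m + (\<Sum>i=n-m+1..n. g i x)) \<partial>?P) \<le> ennreal (real m)"
    using m by (simp add: U_def)
  moreover have int: "integrable ?P (\<lambda>x. \<Sum>i=n-m+1..n. g i x)"
  proof (intro P.integrable_const_bound[where B="real m"] AE_I2 D)
    show "norm (\<Sum>i=n-m+1..n. g i x) \<le> real m" for x
      using lower[of n x] upper[of x] unfolding real_norm_def by linarith
  qed
  moreover have "0 \<le> real m + (\<Sum>i=n-m+1..n. g i x)" for x
    using lower[of n x] by simp
  ultimately have "(\<integral>x. real m + (\<Sum>i=n-m+1..n. g i x) \<partial>?P) \<le> real m"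
    using P.integrable_const[of "real m"]
    by (subst (asm) nn_integral_eq_integral)
      (simp_all del: Bochner_Integration.integral_add Bochner_Integration.integral_sum Bochner_Integration.integrable_sum)
  then have "(\<integral>x. (\<Sum>i=n-m+1..n. g i x) \<partial>?P) \<le> 0"
    unfolding Bochner_Integration.integral_add[OF P.integrable_const int] lebesgue_integral_const P.prob_space
    by simp
  then show ?thesis
    unfolding g_def .
qed

section \<open>Exchangeability and decay of the expected missing mass\<close>

lemma missing_reindex:
  "missing S (\<lambda>i\<in>S. x (\<sigma> i)) = missing (\<sigma> ` S) x"
  unfolding missing_def by (simp cong: INF_cong_simp)

text \<open>Missing masses depend only on the set of sample values, so repeating sample points transfers
  measurability from sample size \<open>n\<close> to all smaller sizes.\<close>

lemma measurable_missing:
  assumes n: "missing {1..n} \<in> borel_measurable (sample_law \<mu> n)"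
    and S: "finite S" "S \<noteq> {}" "card S \<le> n" "S \<subseteq> I"
  shows "missing S \<in> borel_measurable (Pi\<^sub>M I (\<lambda>_. \<mu>))"
proof -
  obtain h where h: "bij_betw h {1..card S} S"
    using ex_bij_betw_nat_finite_1[OF S(1)] by blast
  define \<sigma> where "\<sigma> = (\<lambda>i. h (min i (card S)))"
  have "1 \<le> card S" using S by (simp add: Suc_le_eq card_gt_0_iff)
  then have "(\<lambda>i. min i (card S)) ` {1..n} = {1..card S}"
    using S(3) by (force simp: image_iff)
  then have img: "\<sigma> ` {1..n} = S"
    using h unfolding \<sigma>_def bij_betw_def by (metis image_image)
  have "(\<lambda>x. \<lambda>i\<in>{1..n}. x (\<sigma> i)) \<in> Pi\<^sub>M I (\<lambda>_. \<mu>) \<rightarrow>\<^sub>M sample_law \<mu> n"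
    using img S(4) by (intro measurable_restrict measurable_component_singleton) auto
  from measurable_compose[OF this n] show ?thesis
    unfolding missing_reindex img .
qed

text \<open>Selecting distinct coordinates of an i.i.d. sample yields an i.i.d. sample, so only the
  number of selected points matters.\<close>

lemma integral_missing_card:
  assumes n: "missing {1..n} \<in> borel_measurable (sample_law \<mu> n)"
    and S: "S \<noteq> {}" "S \<subseteq> {1..n}"
  shows "(\<integral>x. missing S x \<partial>sample_law \<mu> n)
    = (\<integral>x. missing {1..card S} x \<partial>sample_law \<mu> (card S))"
proof -
  let ?j = "card S"
  have fin: "finite S" using S finite_subset by blast
  have j: "1 \<le> ?j" "?j \<le> n"
    using S fin card_mono[of "{1..n}" S] by (auto simp: Suc_le_eq card_gt_0_iff)
  obtain h where h: "bij_betw h {1..?j} S"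
    using ex_bij_betw_nat_finite_1[OF fin] by blast
  have hS: "h ` {1..?j} = S" using h by (simp add: bij_betw_def)
  have meas: "missing {1..?j} \<in> borel_measurable (sample_law \<mu> ?j)"
    using j by (intro measurable_missing[OF n]) auto
  have distr: "distr (sample_law \<mu> n) (sample_law \<mu> ?j) (\<lambda>x. \<lambda>i\<in>{1..?j}. x (h i)) = sample_law \<mu> ?j"
    using h S(2) by (intro distr_PiM_reindex prob_space_axioms) (auto simp: bij_betw_def)
  have "(\<integral>x. missing {1..?j} x \<partial>sample_law \<mu> ?j)
      = (\<integral>x. missing {1..?j} (\<lambda>i\<in>{1..?j}. x (h i)) \<partial>sample_law \<mu> n)"
    using hS S(2)
    by (subst distr[symmetric], intro integral_distr meas measurable_restrict measurable_component_singleton)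
      blast
  also have "\<dots> = (\<integral>x. missing S x \<partial>sample_law \<mu> n)"
    unfolding missing_reindex hS ..
  finally show ?thesis by simp
qed

lemma sum_missing_remove_le:
  assumes "finite S"
  shows "(\<Sum>i\<in>S. missing (S - {i}) x - missing S x) \<le> 1"
proof -
  \<comment> \<open>For \<open>i\<close> in \<open>S\<close>, \<open>D i\<close> holds the points
    that \<open>A (x i)\<close> alone excludes; no point is excluded alone by two different
    indices.\<close>
  define D where "D = (\<lambda>i. (\<Inter>k\<in>S - {i}. A (x k)) - (\<Inter>k\<in>S. A (x k)))"
  have D: "D i \<in> sets \<mu>" for i
    using assms unfolding D_def by (intro sets.Diff sets_INT_A) auto
  have "(\<Sum>i\<in>S. missing (S - {i}) x - missing S x) = (\<Sum>i\<in>S. prob (D i))"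
    unfolding missing_def D_def using assms
    by (intro sum.cong finite_measure_Diff[symmetric] sets_INT_A) auto
  also have "\<dots> = prob (\<Union>i\<in>S. D i)"
  proof (rule finite_measure_finite_Union[symmetric])
    show "disjoint_family_on D S"
      unfolding disjoint_family_on_def D_def by blast
  qed (use assms D in auto)
  also have "\<dots> \<le> 1" by simp
  finally show ?thesis .
qed

lemma integral_missing_diff_le:
  assumes n: "missing {1..n} \<in> borel_measurable (sample_law \<mu> n)"
    and j: "1 \<le> j" "j < n"
  shows "(\<integral>x. missing {1..j} x \<partial>sample_law \<mu> n) - (\<integral>x. missing {1..Suc j} x \<partial>sample_law \<mu> n)
    \<le> 1 / real (Suc j)" (is "?a j - ?a (Suc j) \<le> _")
proof -
  let ?P = "sample_law \<mu> n" and ?S = "{1..Suc j}"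
  interpret P: prob_space ?P by (rule prob_space_PiM) (rule prob_space_axioms)
  have int: "integrable ?P (missing T)" if "T \<noteq> {}" "T \<subseteq> {1..n}" for T
    using that finite_subset[of T "{1..n}"] card_mono[of "{1..n}" T]
    by (intro P.integrable_const_bound[where B=1] measurable_missing[OF n]) auto
  \<comment> \<open>Since \<open>j \<ge> 1\<close>, both 1 and 2 lie in \<open>?S\<close>, and one
    of them survives the removal of \<open>i\<close>; transferring measurability needs a point to
    repeat.\<close>
  have ne: "?S - {i} \<noteq> {}" for i
  proof -
    have "(if i = 1 then 2 else 1) \<in> ?S - {i}" using j by auto
    then show ?thesis by blast
  qed
  have eq: "(\<integral>x. missing (?S - {i}) x \<partial>?P) = ?a j" if "i \<in> ?S" for i
  proof -
    have "card (?S - {i}) = j" using that by simp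
    moreover have "?S - {i} \<subseteq> {1..n}" "{1..j} \<subseteq> {1..n}" "{1..j} \<noteq> {}" using j by auto
    ultimately show ?thesis
      using integral_missing_card[OF n ne[of i]] integral_missing_card[OF n, of "{1..j}"] by simp
  qed
  have "real (Suc j) * (?a j - ?a (Suc j)) = (\<Sum>i\<in>?S. (\<integral>x. missing (?S - {i}) x \<partial>?P) - ?a (Suc j))"
    using eq by simp
  also have "\<dots> = (\<integral>x. (\<Sum>i\<in>?S. missing (?S - {i}) x - missing ?S x) \<partial>?P)"
  proof -
    have "integrable ?P (missing (?S - {i}))" "integrable ?P (missing ?S)" for i
      using j by (intro int ne; auto)+
    then show ?thesis by simp
  qed
  also have "\<dots> \<le> (\<integral>x. 1 \<partial>?P)"
  proof (rule integral_mono)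
    show "integrable ?P (\<lambda>x. \<Sum>i\<in>?S. missing (?S - {i}) x - missing ?S x)"
      using j ne by (intro Bochner_Integration.integrable_sum Bochner_Integration.integrable_diff int) auto
    show "(\<Sum>i\<in>?S. missing (?S - {i}) x - missing ?S x) \<le> 1" for x
      by (rule sum_missing_remove_le) simp
  qed (rule P.integrable_const)
  finally show ?thesis
    unfolding lebesgue_integral_const P.prob_space by (simp add: field_simps)
qed

text \<open>The form in which the one-step bounds \<open>1 / real (Suc k)\<close> telescope to a
  logarithm.\<close>

lemma inverse_Suc_le_ln: "0 < k \<Longrightarrow> 1 / real (Suc k) \<le> ln (real (Suc k) / real k)"
proof -
  assume "0 < k"
  then have "ln (real k / real (Suc k)) \<le> real k / real (Suc k) - 1"
    by (intro ln_le_minus_one) auto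
  with \<open>0 < k\<close> show ?thesis
    by (simp add: ln_div field_simps)
qed

lemma integral_missing_diff_le_ln:
  assumes n: "missing {1..n} \<in> borel_measurable (sample_law \<mu> n)"
    and "1 \<le> j" "j \<le> k" "k \<le> n"
  shows "(\<integral>x. missing {1..j} x \<partial>sample_law \<mu> n) - (\<integral>x. missing {1..k} x \<partial>sample_law \<mu> n)
    \<le> ln (real k / real j)"
  using assms(3,4)
proof (induction k rule: dec_induct)
  case base
  then show ?case using assms(2) by simp
next
  case (step k)
  then have "ln (real (Suc k) / real j) = ln (real k / real j) + ln (real (Suc k) / real k)"
    using assms(2) by (simp add: ln_div)
  then show ?case
    using step integral_missing_diff_le[OF n, of k] inverse_Suc_le_ln[of k] assms(2) by simp
qed

text \<open>Inserting \<open>missing {1..k-1} x\<close> splits each summand into a martingale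
  difference and a drift \<open>missing {1..k-1} x - missing {1..n} x\<close>, whose mean is at most
  \<open>ln (n / (k - 1))\<close>.\<close>

lemma expected_excess_le:
  assumes m: "1 \<le> m" "m < n"
    and T: "(\<lambda>x. (1 / real m) * (\<Sum>k=n-m+1..n. novel k x)) \<in> borel_measurable (sample_law \<mu> n)"
    and n: "missing {1..n} \<in> borel_measurable (sample_law \<mu> n)"
  shows "(\<integral>x. (1 / real m) * (\<Sum>k=n-m+1..n. novel k x) - missing {1..n} x \<partial>sample_law \<mu> n)
    \<le> ln (real n / (real n - real m))" (is "?L \<le> ?R")
proof -
  let ?P = "sample_law \<mu> n" and ?K = "{n-m+1..n}"
  interpret P: prob_space ?P by (rule prob_space_PiM) (rule prob_space_axioms)
  have int: "integrable ?P (missing {1..j})" if "1 \<le> j" "j \<le> n" for j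
    using that by (intro P.integrable_const_bound[where B=1] measurable_missing[OF n]) auto
  \<comment> \<open>For these \<open>k\<close>, \<open>k - 1 \<ge> n - m \<ge> 1\<close>: the index
    set is nonempty, and the worst drift is the one at \<open>n - m\<close>.\<close>
  have int': "integrable ?P (missing {1..k-1})" if "k \<in> ?K" for k
    using that m by (intro int) auto
  \<comment> \<open>Measurability is given for the whole sum of the \<open>novel k\<close>, not for
    its terms, so the sum is integrated as one function.\<close>
  have [measurable]: "(\<lambda>x. \<Sum>k\<in>?K. novel k x) \<in> borel_measurable ?P"
    using borel_measurable_times[OF borel_measurable_const T, of "real m"] m by simp
  have intT: "integrable ?P (\<lambda>x. \<Sum>k\<in>?K. novel k x)"
  proof (rule P.integrable_const_bound[where B="real m"])
    show "AE x in ?P. norm (\<Sum>k\<in>?K. novel k x) \<le> real m"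
      using sum_mono[of ?K "\<lambda>k. novel k _" "\<lambda>_. 1"] m by (auto simp: sum_nonneg)
  qed measurable
  have intM: "integrable ?P (\<lambda>x. \<Sum>k\<in>?K. missing {1..k-1} x)"
    by (intro Bochner_Integration.integrable_sum int')
  have D: "(\<integral>x. (\<Sum>k\<in>?K. novel k x - missing {1..k-1} x) \<partial>?P) \<le> 0"
    using m borel_measurable_integrable[OF Bochner_Integration.integrable_diff[OF intT intM]]
    by (intro novel_martingale) (auto simp: sum_subtractf)
  have "(\<integral>x. (\<Sum>k\<in>?K. missing {1..k-1} x - missing {1..n} x) \<partial>?P)
      = (\<Sum>k\<in>?K. (\<integral>x. missing {1..k-1} x \<partial>?P) - (\<integral>x. missing {1..n} x \<partial>?P))"
    using int' int[of n] m by (subst Bochner_Integration.integral_sum) auto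
  also have "\<dots> \<le> (\<Sum>k\<in>?K. ?R)"
  proof (rule sum_mono)
    fix k assume k: "k \<in> ?K"
    then have "(\<integral>x. missing {1..k-1} x \<partial>?P) - (\<integral>x. missing {1..n} x \<partial>?P) \<le> ln (real n / real (k - 1))"
      using m by (intro integral_missing_diff_le_ln[OF n]) auto
    also have "\<dots> \<le> ?R"
      using k m by (intro ln_mono divide_left_mono) auto
    finally show "(\<integral>x. missing {1..k-1} x \<partial>?P) - (\<integral>x. missing {1..n} x \<partial>?P) \<le> ?R" .
  qed
  also have "\<dots> = real m * ?R" using m by simp
  finally have R: "(\<integral>x. (\<Sum>k\<in>?K. missing {1..k-1} x - missing {1..n} x) \<partial>?P) \<le> real m * ?R" .
  have "real m * ?L = (\<integral>x. real m * ((1 / real m) * (\<Sum>k\<in>?K. novel k x) - missing {1..n} x) \<partial>?P)"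
    by simp
  also have "\<dots> = (\<integral>x. (\<Sum>k\<in>?K. novel k x - missing {1..k-1} x)
      + (\<Sum>k\<in>?K. missing {1..k-1} x - missing {1..n} x) \<partial>?P)"
    using m by (intro Bochner_Integration.integral_cong) (auto simp: sum_subtractf algebra_simps)
  also have "\<dots> = (\<integral>x. (\<Sum>k\<in>?K. novel k x - missing {1..k-1} x) \<partial>?P)
      + (\<integral>x. (\<Sum>k\<in>?K. missing {1..k-1} x - missing {1..n} x) \<partial>?P)"
    using intT intM int[of n] m
    by (intro Bochner_Integration.integral_add) (auto simp: sum_subtractf simp del: One_nat_def)
  finally have "real m * ?L \<le> real m * ?R" using D R by simp
  then show ?thesis using m by simp
qed

end

section \<open>Instantiation with complements of closed balls\<close>

theorem theorem2p2:
  fixes \<mu> :: "'a::t2_space measure"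
    and d :: "'a \<Rightarrow> 'a \<Rightarrow> real"
    and r :: real and n m :: nat
  assumes "prob_space \<mu>" and "sets \<mu> = sets borel"
    and "continuous_on UNIV (\<lambda>(x, y). d x y)"
    and "\<And>x y. 0 \<le> d x y" and "\<And>x. d x x = 0" and "\<And>x y. d x y = d y x"
    and "1 \<le> n" and "m \<in> {1..n}" and "0 \<le> r"
  shows
    "(\<forall>t>0. \<P>(x in sample_law \<mu> n. cond_missing_mass \<mu> d r n x - mass_estimator d r n m x > t)
        \<le> exp (- (real m * t\<^sup>2 / 2)))
     \<and> (\<forall>t>0. \<P>(x in sample_law \<mu> n. cond_missing_mass \<mu> d r n x - 2 * mass_estimator d r n m x > t)
        \<le> exp (- (real m * t / (4 * (exp 1 - 2)))))
     \<and> (m < n \<longrightarrow>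
          (mass_estimator d r n m \<in> borel_measurable (sample_law \<mu> n)
           \<and> cond_missing_mass \<mu> d r n \<in> borel_measurable (sample_law \<mu> n)
           \<longrightarrow> (\<integral>x. mass_estimator d r n m x - cond_missing_mass \<mu> d r n x \<partial>sample_law \<mu> n)
                 \<le> ln (real n / (real n - real m)))
          \<and> ln (real n / (real n - real m)) \<le> real m / (real n - real m))"
proof -
  have sp: "space \<mu> = UNIV"
    using sets_eq_imp_space_eq[OF assms(2)] by simp
  have "- gball d x r \<in> sets \<mu>" for x
  proof -
    have "continuous_on UNIV (\<lambda>y. d x y)"
      using continuous_on_compose2[OF assms(3) continuous_on_Pair[OF continuous_on_const continuous_on_id], of x UNIV]
      by simp
    then have "closed (gball d x r)"
      unfolding gball_def by (intro closed_Collect_le) auto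
    then show ?thesis
      by (simp add: assms(2) borel_comp)
  qed
  then interpret exploration \<mu> "\<lambda>x. - gball d x r"
    using assms(1) sp by (auto simp: exploration_def exploration_axioms_def)
  have mass: "cond_missing_mass \<mu> d r n = missing {1..n}"
    by (auto simp: cond_missing_mass_def missing_def fun_eq_iff)
  have est: "mass_estimator d r n m = (\<lambda>x. (1 / real m) * (\<Sum>k=n-m+1..n. novel k x))"
    by (auto simp: mass_estimator_def novel_def fun_eq_iff)
  \<comment> \<open>With \<open>s = l\<^sup>2 / 2\<close> the exponent
    \<open>m * (s - l * t)\<close> is smallest at \<open>l = t\<close>.\<close>
  have "\<P>(x in sample_law \<mu> n. cond_missing_mass \<mu> d r n x - mass_estimator d r n m x > t)
      \<le> exp (- (real m * t\<^sup>2 / 2))" if "t > 0" for t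
    using chernoff_missing[OF assms(8), of t 1 "t\<^sup>2 / 2" t] mgf_variance_bound[of t] that
    unfolding mass est by (simp add: power2_eq_square algebra_simps)
  moreover have "\<P>(x in sample_law \<mu> n. cond_missing_mass \<mu> d r n x - 2 * mass_estimator d r n m x > t)
      \<le> exp (- (real m * t / (4 * (exp 1 - 2))))" if "t > 0" for t
  proof -
    \<comment> \<open>The value of \<open>l\<close> is the claimed rate, taken with
      \<open>s = 0\<close>. The restriction \<open>l \<le> 1 / 2\<close> amounts to
      \<open>exp 1 \<ge> 5 / 2\<close>.\<close>
    define l :: real where "l = 1 / (4 * (exp 1 - 2))"
    have "5 / 2 \<le> (exp 1 :: real)"
      using exp_lower_Taylor_quadratic[of 1] by simp
    then have "0 \<le> l" "l \<le> 1 / 2"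
      by (auto simp: l_def field_simps)
    then have "\<P>(x in sample_law \<mu> n. cond_missing_mass \<mu> d r n x - 2 * mass_estimator d r n m x > t)
        \<le> exp (real m * (0 - l * t))"
      unfolding mass est using mgf_relative_bound[of l] assms(8)
      by (intro chernoff_missing) auto
    then show ?thesis
      by (simp add: l_def)
  qed
  moreover have "ln (real n / (real n - real m)) \<le> real m / (real n - real m)" if "m < n"
    using that ln_le_minus_one[of "real n / (real n - real m)"] by (simp add: field_simps)
  ultimately show ?thesis
    using expected_excess_le[of m n] assms(8) unfolding mass est by auto
qed

end
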